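(* Let $f:\mathbb{R}^n\to\mathbb{R}$ be a scaling-invariant function. There exist a positively homogeneous function $p:\mathbb{R}^n\to\mathbb{R}$ with degree $1$ and a strictly increasing function $\varphi$ such that $f=\varphi\circ p$ if and only if the following holds: for all $x\in\mathbb{R}^n$ the function $f_x$ is either constant or strictly monotonic, all strictly increasing functions among the $f_x$ share the same image (i.e., if $\lambda\in\mathbb{R}$ is reached by one of these functions, then it is reached by all of them), and all strictly decreasing functions among the $f_x$ share the same image. For $f$ not identically zero, the choice of $(\varphi,p)$ is unique up to a left composition of $p$ with a piece-wise linear function.
   Context: A function $f:\mathbb{R}^n\to\mathbb{R}$ is scaling-invariant (w.r.t. $0$) if for all $x,y\in\mathbb{R}^n$ and $\rho>0$: $f(x)\le f(y)\iff f(\rho x)\le f(\rho y)$. Standing convention: scaling-invariant functions are normalized so that the reference point is $0$ and $f(0)=0$. For $x\in\mathbb{R}^n$, $f_x:[0,\infty)\to\mathbb{R}$ is defined by $f_x(t)=f(tx)$. A function $p:\mathbb{R}^n\to\mathbb{R}$ is positively homogeneous with degree $1$ if $p(\rho x)=\rho p(x)$ for all $x\in\mathbb{R}^n$, $\rho>0$. The function $\varphi$ is real-valued and defined on a subset of $\mathbb{R}$ containing $\mathrm{Im}(p)$. "Unique up to a left composition of $p$ with a piece-wise linear function" means: if $f=\varphi\circ p=\bar\varphi\circ\bar p$ are two such decompositions, then $\bar p=\psi\circ p$ where $\psi$ is a function on $\mathrm{Im}(p)$ that is linear on $\mathrm{Im}(p)\cap[0,\infty)$ and linear on $\mathrm{Im}(p)\cap(-\infty,0]$.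 *)

theory Defs
  imports "HOL-Analysis.Analysis"
begin

definition scaling_invariant :: "(real ^ 'n \<Rightarrow> real) \<Rightarrow> bool" where
  "scaling_invariant f \<longleftrightarrow>
     (\<forall>x y. \<forall>\<rho>>0. f x \<le> f y \<longleftrightarrow> f (\<rho> *\<^sub>R x) \<le> f (\<rho> *\<^sub>R y))"

text \<open>The function \<open>t \<mapsto> f (t x)\<close>; its intended domain is \<open>{0..}\<close>, so all properties
  of it are stated relative to that set.\<close>

definition along_ray :: "(real ^ 'n \<Rightarrow> real) \<Rightarrow> real ^ 'n \<Rightarrow> real \<Rightarrow> real" where
  "along_ray f x t = f (t *\<^sub>R x)"

definition pos_homogeneous :: "(real ^ 'n \<Rightarrow> real) \<Rightarrow> bool" where
  "pos_homogeneous p \<longleftrightarrow> (\<forall>x. \<forall>\<rho>>0. p (\<rho> *\<^sub>R x) = \<rho> * p x)"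

text \<open>The outer function \<open>\<phi>\<close> is only defined on a set \<open>D\<close> of reals containing the image of \<open>p\<close>;
  its values outside \<open>D\<close> are irrelevant.\<close>

definition decomposition ::
  "(real ^ 'n \<Rightarrow> real) \<Rightarrow> real set \<Rightarrow> (real \<Rightarrow> real) \<Rightarrow> (real ^ 'n \<Rightarrow> real) \<Rightarrow> bool" where
  "decomposition f D \<phi> p \<longleftrightarrow>
     pos_homogeneous p \<and> range p \<subseteq> D \<and> strict_mono_on D \<phi> \<and> f = \<phi> \<circ> p"

text \<open>Linear is meant in the strict sense: no constant term.\<close>

definition piecewise_linear_on :: "real set \<Rightarrow> (real \<Rightarrow> real) \<Rightarrow> bool" where
  "piecewise_linear_on S \<psi> \<longleftrightarrow>
     (\<exists>a. \<forall>u \<in> S \<inter> {0..}. \<psi> u = a * u) \<and> (\<exists>b. \<forall>u \<in> S \<inter> {..0}. \<psi> u = b * u)"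

end

theory Submission imports Defs begin

text \<open>
  A decomposition of \<open>f\<close> is the same as a positively homogeneous \<open>p\<close> that orders the points of the
  space exactly as \<open>f\<close> does. On a ray where \<open>f\<close> increases, the common image lets one measure every
  point \<open>x\<close> with \<open>f x > 0\<close> against a single reference ray through \<open>e\<close>: the value \<open>p x\<close> is the unique
  \<open>t\<close> with \<open>f x = f (t e)\<close>, and scaling invariance makes it homogeneous. Points with \<open>f x < 0\<close> are
  treated by passing to \<open>- f\<close>. Uniqueness holds because two homogeneous functions inducing the same
  order are proportional on each of the two half-lines of values.
\<close>

section \<open>Scaling behaviour of homogeneous and scaling-invariant functions\<close>

lemma pos_homogeneous_zero:
  fixes p :: "real ^ 'n \<Rightarrow> real"
  assumes "pos_homogeneous p"
  shows "p 0 = 0"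
proof -
  \<comment> \<open>Scaling fixes the origin, so any factor other than 1 forces the value 0
    there.\<close>
  have "p (2 *\<^sub>R 0) = 2 * p 0"
    using assms unfolding pos_homogeneous_def by (meson zero_less_numeral)
  then show ?thesis by simp
qed

lemma pos_homogeneous_scaleR:
  fixes p :: "real ^ 'n \<Rightarrow> real"
  assumes "pos_homogeneous p" "t \<ge> 0"
  shows "p (t *\<^sub>R x) = t * p x"
  using assms pos_homogeneous_zero[OF assms(1)]
  by (cases "t = 0") (auto simp: pos_homogeneous_def)

lemma pos_homogeneous_minus:
  "pos_homogeneous p \<Longrightarrow> pos_homogeneous (\<lambda>x. - p x)"
  by (simp add: pos_homogeneous_def)

lemma scaling_invariant_minus:
  "scaling_invariant f \<Longrightarrow> scaling_invariant (\<lambda>x. - f x)"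
  unfolding scaling_invariant_def neg_le_iff_le by blast

lemma scaling_invariant_eq_iff:
  assumes "scaling_invariant f" "\<rho> > 0"
  shows "f (\<rho> *\<^sub>R x) = f (\<rho> *\<^sub>R y) \<longleftrightarrow> f x = f y"
proof -
  have "f u \<le> f v \<longleftrightarrow> f (\<rho> *\<^sub>R u) \<le> f (\<rho> *\<^sub>R v)" for u v
    using assms unfolding scaling_invariant_def by blast
  then show ?thesis
    by (simp add: order_eq_iff)
qed

lemma scaling_invariant_pos_iff:
  assumes "scaling_invariant f" "f 0 = 0" "\<rho> > 0"
  shows "f (\<rho> *\<^sub>R x) > 0 \<longleftrightarrow> f x > 0"
proof -
  have "f x \<le> f 0 \<longleftrightarrow> f (\<rho> *\<^sub>R x) \<le> f (\<rho> *\<^sub>R 0)"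
    using assms unfolding scaling_invariant_def by blast
  then show ?thesis
    using assms(2) by (simp flip: not_le)
qed

section \<open>Decompositions as order representations\<close>

lemma decomposition_le_iff:
  assumes "decomposition f D \<phi> p"
  shows "f x \<le> f y \<longleftrightarrow> p x \<le> p y"
proof -
  have "p x \<in> D" "p y \<in> D" "strict_mono_on D \<phi>" "f = \<phi> \<circ> p"
    using assms by (auto simp: decomposition_def)
  then show ?thesis
    using strict_mono_on_less_eq by fastforce
qed

text \<open>This eliminates \<open>D\<close> and \<phi>: once \<open>p\<close> induces the order of
  \<open>f\<close>, equal values of \<open>p\<close> force equal values of \<open>f\<close>, so
  evaluating \<open>f\<close> at any chosen preimage recovers \<phi> on
  \<open>range p\<close>.\<close>

lemma decomposition_exists_iff:
  fixes f :: "real ^ 'n \<Rightarrow> real"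
  shows "(\<exists>p D \<phi>. decomposition f D \<phi> p) \<longleftrightarrow>
    (\<exists>p. pos_homogeneous p \<and> (\<forall>x y. f x \<le> f y \<longleftrightarrow> p x \<le> p y))"
proof
  assume "\<exists>p D \<phi>. decomposition f D \<phi> p"
  then show "\<exists>p. pos_homogeneous p \<and> (\<forall>x y. f x \<le> f y \<longleftrightarrow> p x \<le> p y)"
    using decomposition_le_iff unfolding decomposition_def by blast
next
  assume "\<exists>p. pos_homogeneous p \<and> (\<forall>x y. f x \<le> f y \<longleftrightarrow> p x \<le> p y)"
  then obtain p where hom: "pos_homogeneous p" and ord: "\<And>x y. f x \<le> f y \<longleftrightarrow> p x \<le> p y"
    by blast
  have inv: "p (inv p (p x)) = p x" for x
    by (simp add: f_inv_into_f)
  have "strict_mono_on (range p) (f \<circ> inv p)"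
  proof (rule strict_mono_onI)
    fix u v assume "u \<in> range p" "v \<in> range p" "u < v"
    then show "(f \<circ> inv p) u < (f \<circ> inv p) v"
      using inv ord by (auto simp flip: not_le)
  qed
  moreover have "f = (f \<circ> inv p) \<circ> p"
  proof
    fix x
    show "f x = ((f \<circ> inv p) \<circ> p) x"
      by (rule order_antisym) (simp_all add: ord inv)
  qed
  ultimately have "decomposition f (range p) (f \<circ> inv p) p"
    using hom by (simp add: decomposition_def)
  then show "\<exists>p D \<phi>. decomposition f D \<phi> p" by blast
qed

section \<open>Measuring positive values along a reference ray\<close>

text \<open>Only the points with \<open>f x > 0\<close> are measured, so that the result can be
  applied to \<open>f\<close> and to its negative and the two gauges glued.\<close>

lemma positive_part_gauge:
  fixes f :: "real ^ 'n \<Rightarrow> real"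
  assumes si: "scaling_invariant f" and f0: "f 0 = 0"
    and mono: "\<And>x. f x > 0 \<Longrightarrow> strict_mono_on {0..} (along_ray f x)"
    and image: "\<And>x y. f x > 0 \<Longrightarrow> f y > 0 \<Longrightarrow> along_ray f x ` {0..} = along_ray f y ` {0..}"
  obtains q where "pos_homogeneous q" "\<And>x. f x \<le> 0 \<Longrightarrow> q x = 0" "\<And>x. f x > 0 \<Longrightarrow> q x > 0"
    "\<And>x y. f x > 0 \<Longrightarrow> f y > 0 \<Longrightarrow> f x \<le> f y \<longleftrightarrow> q x \<le> q y"
proof (cases "\<exists>e. f e > 0")
  case False
  then show thesis
    using that[of "\<lambda>x. 0"] by (auto simp: pos_homogeneous_def)
next
  case True
  then obtain e where e: "f e > 0" by blast
  have ray_le: "f (s *\<^sub>R e) \<le> f (t *\<^sub>R e) \<longleftrightarrow> s \<le> t" if "s \<ge> 0" "t \<ge> 0" for s t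
    using strict_mono_on_less_eq[OF mono[OF e]] that by (simp add: along_ray_def)
  have ex: "\<exists>t. t > 0 \<and> f x = f (t *\<^sub>R e)" if "f x > 0" for x
  proof -
    \<comment> \<open>The value \<open>f x\<close> is attained on its own ray at parameter 1, hence
      on the ray through \<open>e\<close>.\<close>
    have "along_ray f x 1 \<in> along_ray f e ` {0..}"
      using image[OF that e] by force
    then obtain t where t: "t \<ge> 0" "f x = f (t *\<^sub>R e)"
      by (auto simp: along_ray_def)
    then have "t \<noteq> 0"
      using that f0 by auto
    with t show ?thesis
      by (intro exI[of _ t]) simp
  qed
  \<comment> \<open>The choice is unique, since \<open>f\<close> is injective along the ray through
    \<open>e\<close>. The default 0 is compatible with homogeneity because scaling preserves the set
    where \<open>f\<close> is positive.\<close>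
  define q where "q x = (if f x > 0 then SOME t. t > 0 \<and> f x = f (t *\<^sub>R e) else 0)" for x
  have q: "q x > 0 \<and> f x = f (q x *\<^sub>R e)" if "f x > 0" for x
    using someI_ex[OF ex[OF that]] that by (simp add: q_def)
  have q_eq: "q x = t" if "f x > 0" "t > 0" "f x = f (t *\<^sub>R e)" for x t
    using q[OF that(1)] that ray_le[of "q x" t] ray_le[of t "q x"] by simp
  have "pos_homogeneous q"
    unfolding pos_homogeneous_def
  proof (intro allI impI)
    fix x and \<rho> :: real assume \<rho>: "\<rho> > 0"
    show "q (\<rho> *\<^sub>R x) = \<rho> * q x"
    proof (cases "f x > 0")
      case True
      then have "f (\<rho> *\<^sub>R x) = f (\<rho> *\<^sub>R q x *\<^sub>R e)"
        using q scaling_invariant_eq_iff[OF si \<rho>] by blast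
      moreover have "f (\<rho> *\<^sub>R x) > 0"
        using True scaling_invariant_pos_iff[OF si f0 \<rho>] by blast
      ultimately show ?thesis
        using q[OF True] \<rho> by (intro q_eq) simp_all
    next
      case False
      then have "\<not> f (\<rho> *\<^sub>R x) > 0"
        using scaling_invariant_pos_iff[OF si f0 \<rho>] by blast
      with False show ?thesis
        by (simp add: q_def)
    qed
  qed
  moreover have "f x \<le> f y \<longleftrightarrow> q x \<le> q y" if "f x > 0" "f y > 0" for x y
    using q[OF that(1)] q[OF that(2)] ray_le[of "q x" "q y"] by simp
  ultimately show thesis
    using that[of q] q by (simp add: q_def)
qed

section \<open>Ray types and signs\<close>

lemma along_ray_strict_mono_pos:
  assumes "f 0 = 0" "strict_mono_on {0..} (along_ray f x)"
  shows "f x > 0"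
  using strict_mono_onD[OF assms(2), of 0 1] assms(1) by (simp add: along_ray_def)

lemma along_ray_strict_antimono_neg:
  assumes "f 0 = 0" "strict_antimono_on {0..} (along_ray f x)"
  shows "f x < 0"
  using monotone_onD[OF assms(2), of 0 1] assms(1) by (simp add: along_ray_def)

lemma along_ray_constant_zero:
  assumes "f 0 = 0" "along_ray f x constant_on {0..}"
  shows "f x = 0"
proof -
  obtain c where c: "\<And>t. t \<ge> 0 \<Longrightarrow> f (t *\<^sub>R x) = c"
    using assms(2) unfolding constant_on_def along_ray_def by auto
  show ?thesis
    using c[of 0] c[of 1] assms(1) by simp
qed

lemma decomposition_along_ray:
  assumes "decomposition f D \<phi> p" "t \<ge> 0"
  shows "along_ray f x t = \<phi> (t * p x)"
  using assms by (auto simp: decomposition_def along_ray_def pos_homogeneous_scaleR)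

text \<open>Along the ray through \<open>x\<close>, \<open>f\<close> orders the parameters
  \<open>t\<close> as \<open>t * p x\<close> does, so the sign of \<open>p x\<close> decides the
  type.\<close>

lemma decomposition_along_ray_cases:
  assumes "decomposition f D \<phi> p"
  shows "p x = 0 \<Longrightarrow> along_ray f x constant_on {0..}"
    and "p x > 0 \<Longrightarrow> strict_mono_on {0..} (along_ray f x)"
    and "p x < 0 \<Longrightarrow> strict_antimono_on {0..} (along_ray f x)"
proof -
  have hom: "pos_homogeneous p"
    using assms by (simp add: decomposition_def)
  have le: "along_ray f x s < along_ray f x t \<longleftrightarrow> s * p x < t * p x" if "s \<ge> 0" "t \<ge> 0" for s t
    using decomposition_le_iff[OF assms] that pos_homogeneous_scaleR[OF hom]
    by (simp add: along_ray_def flip: not_le)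
  show "along_ray f x constant_on {0..}" if "p x = 0"
    using decomposition_along_ray[OF assms] that by (auto simp: constant_on_def)
  show "strict_mono_on {0..} (along_ray f x)" if "p x > 0"
    using that le by (auto intro!: strict_mono_onI)
  show "strict_antimono_on {0..} (along_ray f x)" if "p x < 0"
    using that le by (auto intro!: monotone_onI)
qed

text \<open>As \<open>t\<close> runs through \<open>{0..}\<close>, \<open>t * p x\<close> fills a
  half-line that depends only on the sign of \<open>p x\<close>. This half-line lies in
  \<open>range p\<close>, hence in \<open>D\<close>.\<close>

lemma decomposition_along_ray_image:
  assumes "decomposition f D \<phi> p"
  shows "p x > 0 \<Longrightarrow> along_ray f x ` {0..} = \<phi> ` {0..}"
    and "p x < 0 \<Longrightarrow> along_ray f x ` {0..} = \<phi> ` {..0}"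
proof -
  have img: "along_ray f x ` {0..} = \<phi> ` (\<lambda>t. t * p x) ` {0..}"
    using decomposition_along_ray[OF assms] by (auto simp: image_image)
  show "along_ray f x ` {0..} = \<phi> ` {0..}" if "p x > 0"
  proof -
    have "u \<in> (\<lambda>t. t * p x) ` {0..}" if "u \<ge> 0" for u
      using that \<open>p x > 0\<close> by (intro image_eqI[of _ _ "u / p x"]) auto
    then have "(\<lambda>t. t * p x) ` {0..} = {0..}"
      using \<open>p x > 0\<close> by auto
    then show ?thesis using img by simp
  qed
  show "along_ray f x ` {0..} = \<phi> ` {..0}" if "p x < 0"
  proof -
    have "u \<in> (\<lambda>t. t * p x) ` {0..}" if "u \<le> 0" for u
      using that \<open>p x < 0\<close> by (intro image_eqI[of _ _ "u / p x"]) (auto simp: divide_nonpos_neg)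
    then have "(\<lambda>t. t * p x) ` {0..} = {..0}"
      using \<open>p x < 0\<close> by (auto simp: mult_nonneg_nonpos)
    then show ?thesis using img by simp
  qed
qed

lemma decomposition_imp_ray_conditions:
  fixes f :: "real ^ 'n \<Rightarrow> real"
  assumes dec: "decomposition f D \<phi> p" and f0: "f 0 = 0"
  shows "along_ray f x constant_on {0..} \<or> strict_mono_on {0..} (along_ray f x) \<or>
      strict_antimono_on {0..} (along_ray f x)"
    and "strict_mono_on {0..} (along_ray f x) \<Longrightarrow> strict_mono_on {0..} (along_ray f y) \<Longrightarrow>
      along_ray f x ` {0..} = along_ray f y ` {0..}"
    and "strict_antimono_on {0..} (along_ray f x) \<Longrightarrow> strict_antimono_on {0..} (along_ray f y) \<Longrightarrow>
      along_ray f x ` {0..} = along_ray f y ` {0..}"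
proof -
  have p0: "p 0 = 0"
    using dec pos_homogeneous_zero by (auto simp: decomposition_def)
  \<comment> \<open>Both \<open>f\<close> and \<open>p\<close> vanish at the origin, so comparing
    \<open>z\<close> with it transfers the sign of \<open>f z\<close> to \<open>p z\<close>.\<close>
  have pos: "p z > 0" if "strict_mono_on {0..} (along_ray f z)" for z
    using along_ray_strict_mono_pos[of f, OF f0 that] decomposition_le_iff[OF dec, of z 0] f0 p0 by simp
  have neg: "p z < 0" if "strict_antimono_on {0..} (along_ray f z)" for z
    using along_ray_strict_antimono_neg[of f, OF f0 that] decomposition_le_iff[OF dec, of 0 z] f0 p0 by simp
  show "along_ray f x constant_on {0..} \<or> strict_mono_on {0..} (along_ray f x) \<or>
      strict_antimono_on {0..} (along_ray f x)"
    using decomposition_along_ray_cases[OF dec] by (metis linorder_less_linear)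
  show "along_ray f x ` {0..} = along_ray f y ` {0..}"
    if "strict_mono_on {0..} (along_ray f x)" "strict_mono_on {0..} (along_ray f y)"
    using that by (simp add: decomposition_along_ray_image(1)[OF dec pos])
  show "along_ray f x ` {0..} = along_ray f y ` {0..}"
    if "strict_antimono_on {0..} (along_ray f x)" "strict_antimono_on {0..} (along_ray f y)"
    using that by (simp add: decomposition_along_ray_image(2)[OF dec neg])
qed

text \<open>The sign of \<open>f x\<close> rules out all ray types but one when it is nonzero. The
  gauge lemma then applies to \<open>f\<close> and to \<open>?g\<close>, whose increasing rays are
  the decreasing rays of \<open>f\<close>.\<close>

lemma ray_conditions_imp_decomposition:
  fixes f :: "real ^ 'n \<Rightarrow> real"
  assumes si: "scaling_invariant f" and f0: "f 0 = 0"
    and rays: "\<And>x. along_ray f x constant_on {0..} \<or> strict_mono_on {0..} (along_ray f x) \<or>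
      strict_antimono_on {0..} (along_ray f x)"
    and inc: "\<And>x y. strict_mono_on {0..} (along_ray f x) \<Longrightarrow>
      strict_mono_on {0..} (along_ray f y) \<Longrightarrow>
      along_ray f x ` {0..} = along_ray f y ` {0..}"
    and dec: "\<And>x y. strict_antimono_on {0..} (along_ray f x) \<Longrightarrow>
      strict_antimono_on {0..} (along_ray f y) \<Longrightarrow>
      along_ray f x ` {0..} = along_ray f y ` {0..}"
  shows "\<exists>p D \<phi>. decomposition f D \<phi> p"
proof -
  have mono: "strict_mono_on {0..} (along_ray f x)" if "f x > 0" for x
    using rays[of x] that along_ray_constant_zero[of f, OF f0] along_ray_strict_antimono_neg[of f, OF f0]
    by fastforce
  have anti: "strict_antimono_on {0..} (along_ray f x)" if "f x < 0" for x
    using rays[of x] that along_ray_constant_zero[of f, OF f0] along_ray_strict_mono_pos[of f, OF f0]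
    by fastforce
  let ?g = "\<lambda>x. - f x"
  have ray_minus: "along_ray ?g x = uminus \<circ> along_ray f x" for x
    by (auto simp: along_ray_def)
  obtain q where q: "pos_homogeneous q" "\<And>x. f x \<le> 0 \<Longrightarrow> q x = 0" "\<And>x. f x > 0 \<Longrightarrow> q x > 0"
    "\<And>x y. f x > 0 \<Longrightarrow> f y > 0 \<Longrightarrow> f x \<le> f y \<longleftrightarrow> q x \<le> q y"
    using positive_part_gauge[OF si f0 mono inc] mono by blast
  obtain r where r: "pos_homogeneous r" "\<And>x. ?g x \<le> 0 \<Longrightarrow> r x = 0" "\<And>x. ?g x > 0 \<Longrightarrow> r x > 0"
    "\<And>x y. ?g x > 0 \<Longrightarrow> ?g y > 0 \<Longrightarrow> ?g x \<le> ?g y \<longleftrightarrow> r x \<le> r y"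
  proof (rule positive_part_gauge[of ?g])
    show "scaling_invariant ?g"
      using si by (rule scaling_invariant_minus)
    show "?g 0 = 0"
      by (simp add: f0)
    show "strict_mono_on {0..} (along_ray ?g x)" if "?g x > 0" for x
      using anti[of x] that by (auto simp: monotone_on_def ray_minus)
    show "along_ray ?g x ` {0..} = along_ray ?g y ` {0..}" if "?g x > 0" "?g y > 0" for x y
    proof -
      have "along_ray ?g z ` {0..} = uminus ` along_ray f z ` {0..}" for z
        by (simp only: ray_minus image_comp)
      then show ?thesis
        using dec[OF anti anti, of x y] that by simp
    qed
  qed blast
  \<comment> \<open>At most one of \<open>q x\<close> and \<open>r x\<close> is nonzero, so
    \<open>p x\<close> has the sign of \<open>f x\<close>. Points of different sign are thereby
    ordered correctly; for two negative points, the sign change reverses the order given by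
    \<open>r\<close>.\<close>
  define p where "p x = q x - r x" for x
  have "pos_homogeneous p"
    using q(1) r(1) by (simp add: pos_homogeneous_def p_def right_diff_distrib)
  moreover have "f x \<le> f y \<longleftrightarrow> p x \<le> p y" for x y
  proof -
    have q0: "q z = 0" if "f z \<le> 0" for z using q(2) that by blast
    have r0: "r z = 0" if "f z \<ge> 0" for z using r(2) that by simp
    have sgn: "f z > 0 \<and> p z = q z \<and> q z > 0 \<or> f z = 0 \<and> p z = 0 \<or> f z < 0 \<and> p z = - r z \<and> r z > 0" for z
      using q0[of z] r0[of z] q(3)[of z] r(3)[of z] unfolding p_def by linarith
    show ?thesis
      using sgn[of x] sgn[of y] q(4)[of x y] r(4)[of y x] by (smt (verit))
  qed
  ultimately show ?thesis
    unfolding decomposition_exists_iff by blast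
qed

section \<open>Uniqueness up to piecewise linear maps\<close>

text \<open>If \<open>p e > 0\<close>, every nonnegative value of \<open>p\<close> is attained on
  the ray through \<open>e\<close>. There both functions are linear in the parameter, which gives
  the slope \<open>p' e / p e\<close>.\<close>

lemma pos_homogeneous_proportional_on_nonneg:
  fixes p p' :: "real ^ 'n \<Rightarrow> real"
  assumes p: "pos_homogeneous p" and p': "pos_homogeneous p'"
    and eq: "\<And>x y. p x = p y \<Longrightarrow> p' x = p' y"
  shows "\<exists>a. \<forall>x. p x \<ge> 0 \<longrightarrow> p' x = a * p x"
proof (cases "\<exists>e. p e > 0")
  case True
  then obtain e where e: "p e > 0" by blast
  have "p' x = p' e / p e * p x" if "p x \<ge> 0" for x
  proof -
    have t: "p x / p e \<ge> 0"
      using e that by simp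
    have "p x = p ((p x / p e) *\<^sub>R e)"
      using pos_homogeneous_scaleR[OF p t] e by simp
    then have "p' x = p' ((p x / p e) *\<^sub>R e)"
      by (rule eq)
    then show ?thesis
      using pos_homogeneous_scaleR[OF p' t] by simp
  qed
  then show ?thesis by blast
next
  case False
  \<comment> \<open>Without positive values of \<open>p\<close>, only points at level 0 remain, and
    they share their value of \<open>p'\<close> with the origin.\<close>
  have "p' x = 0" if "p x \<ge> 0" for x
  proof -
    have "p x = p 0"
      using False that pos_homogeneous_zero[OF p] by (auto simp: not_less intro: order_antisym)
    then show ?thesis
      using eq[of x 0] pos_homogeneous_zero[OF p'] by simp
  qed
  then show ?thesis
    by (intro exI[of _ 0]) simp
qed

lemma pos_homogeneous_factor_piecewise_linear:
  fixes p p' :: "real ^ 'n \<Rightarrow> real"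
  assumes p: "pos_homogeneous p" and p': "pos_homogeneous p'"
    and eq: "\<And>x y. p x = p y \<Longrightarrow> p' x = p' y"
  shows "\<exists>\<psi>. piecewise_linear_on (range p) \<psi> \<and> p' = \<psi> \<circ> p"
proof -
  obtain a where a: "\<And>x. p x \<ge> 0 \<Longrightarrow> p' x = a * p x"
    using pos_homogeneous_proportional_on_nonneg[OF p p' eq] by blast
  \<comment> \<open>Reflecting \<open>p\<close> reduces the negative half-line to the previous
    lemma; the slope in terms of \<open>p\<close> itself is then \<open>- b\<close>.\<close>
  have "\<exists>b. \<forall>x. - p x \<ge> 0 \<longrightarrow> p' x = b * - p x"
    by (rule pos_homogeneous_proportional_on_nonneg[OF pos_homogeneous_minus[OF p] p'])
      (rule eq, simp)
  then obtain b where b: "\<And>x. - p x \<ge> 0 \<Longrightarrow> p' x = b * - p x" by blast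
  define \<psi> where "\<psi> u = (if u \<ge> 0 then a * u else - b * u)" for u
  have "piecewise_linear_on (range p) \<psi>"
    unfolding piecewise_linear_on_def
    by (intro conjI exI[of _ a] exI[of _ "- b"]) (auto simp: \<psi>_def)
  moreover have "p' = \<psi> \<circ> p"
    using a b by (auto simp: \<psi>_def)
  ultimately show ?thesis by blast
qed

theorem theorem3p2:
  fixes f :: "real ^ 'n \<Rightarrow> real"
  assumes "scaling_invariant f" and "f 0 = 0"
  shows
    "((\<exists>p D \<phi>. decomposition f D \<phi> p) \<longleftrightarrow>
       (\<forall>x. along_ray f x constant_on {0..} \<or>
            strict_mono_on {0..} (along_ray f x) \<or>
            strict_antimono_on {0..} (along_ray f x)) \<and>
       (\<forall>x y. strict_mono_on {0..} (along_ray f x) \<longrightarrow>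
              strict_mono_on {0..} (along_ray f y) \<longrightarrow>
              along_ray f x ` {0..} = along_ray f y ` {0..}) \<and>
       (\<forall>x y. strict_antimono_on {0..} (along_ray f x) \<longrightarrow>
              strict_antimono_on {0..} (along_ray f y) \<longrightarrow>
              along_ray f x ` {0..} = along_ray f y ` {0..}))
     \<and>
     ((\<exists>x. f x \<noteq> 0) \<longrightarrow>
       (\<forall>p D \<phi> p' D' \<phi>'.
          decomposition f D \<phi> p \<longrightarrow> decomposition f D' \<phi>' p' \<longrightarrow>
          (\<exists>\<psi>. piecewise_linear_on (range p) \<psi> \<and> p' = \<psi> \<circ> p)))"
proof (intro conjI)
  show "(\<exists>p D \<phi>. decomposition f D \<phi> p) \<longleftrightarrow>
       (\<forall>x. along_ray f x constant_on {0..} \<or>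
            strict_mono_on {0..} (along_ray f x) \<or>
            strict_antimono_on {0..} (along_ray f x)) \<and>
       (\<forall>x y. strict_mono_on {0..} (along_ray f x) \<longrightarrow>
              strict_mono_on {0..} (along_ray f y) \<longrightarrow>
              along_ray f x ` {0..} = along_ray f y ` {0..}) \<and>
       (\<forall>x y. strict_antimono_on {0..} (along_ray f x) \<longrightarrow>
              strict_antimono_on {0..} (along_ray f y) \<longrightarrow>
              along_ray f x ` {0..} = along_ray f y ` {0..})" (is "?L \<longleftrightarrow> ?R")
  proof
    assume ?L
    then obtain p D \<phi> where "decomposition f D \<phi> p" by blast
    note conds = decomposition_imp_ray_conditions[OF this assms(2)]
    show ?R
      by (intro conjI allI impI) (fact conds(1), (rule conds(2,3); assumption)+)
  next
    assume R: ?R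
    show ?L
      by (rule ray_conditions_imp_decomposition[OF assms]) (use R in blast)+
  qed
  show "(\<exists>x. f x \<noteq> 0) \<longrightarrow>
       (\<forall>p D \<phi> p' D' \<phi>'.
          decomposition f D \<phi> p \<longrightarrow> decomposition f D' \<phi>' p' \<longrightarrow>
          (\<exists>\<psi>. piecewise_linear_on (range p) \<psi> \<and> p' = \<psi> \<circ> p))"
  proof (intro impI allI)
    fix p D \<phi> p' D' \<phi>'
    assume d: "decomposition f D \<phi> p" and d': "decomposition f D' \<phi>' p'"
    show "\<exists>\<psi>. piecewise_linear_on (range p) \<psi> \<and> p' = \<psi> \<circ> p"
    proof (rule pos_homogeneous_factor_piecewise_linear)
      show "pos_homogeneous p" "pos_homogeneous p'"
        using d d' by (auto simp: decomposition_def)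
      \<comment> \<open>Both functions induce the order of \<open>f\<close>, so they have the same
        level sets.\<close>
      show "p' x = p' y" if "p x = p y" for x y
        using that decomposition_le_iff[OF d] decomposition_le_iff[OF d']
        by (metis order_antisym order_refl)
    qed
  qed
qed

end
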